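(* Consider the control setting of the context, with action set $\mathcal U$ of diameter $D_{\mathcal U}$, memory parameters $(H,\varepsilon)$, horizon $T$ and reference policy class $\Pi$. Let $\mathcal L'$ be the class of $\beta$-smooth loss functions, from which the losses $\ell_t$ encountered by the booster are taken. Assume oracle access to $N$ copies $\mathcal A_1,\dots,\mathcal A_N$ of a weak controller $\mathcal A$, with respect to the class $\mathcal L$ of linear losses and with regret function $R(T)$, satisfying the truncated-memory regret guarantee (∗) of the context. Then there exists a boosting algorithm (DynaBoost1, described in the context) which produces a sequence of actions $u_1,\dots,u_T$ for which the following regret bound holds with respect to the reference class $\mathrm{conv}(\Pi)$: $$\sum_{t=1}^T \ell_t(u_1,\dots,u_t)-\min_{\pi\in\mathrm{conv}(\Pi)}\sum_{t=1}^T \ell_t(u_1^{\pi},\dots,u_t^{\pi})\;\le\;\frac{2\beta D_{\mathcal U}^2HT}{N}+R(T)+4T\varepsilon .$$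
   Context: **System.** At each round $t\in[T]$ the controller observes the state $x_t\in\mathbb R^k$ and outputs an action $u_t\in\mathcal U\subset\mathbb R^d$, where $\mathcal U$ is a convex bounded set. An adversary then reveals a convex cost function $c_t$, the loss $c_t(x_t,u_t)$ is incurred, and the system moves to $x_{t+1}=f(x_t,u_t)+w_t$, where $f$ is the dynamics and $w_t\in\mathbb R^k$ is an adversarially chosen perturbation with $\|w_t\|_2\le W$. Costs and perturbations are revealed after the controller commits to $u_t$; no distributional assumption is made. Comparators face the same costs and perturbations. **Losses.** $\ell_t(u_1,\dots,u_t)$ denotes the loss $c_t(x_t,u_t)$ at round $t$, where $x_t$ is the state reached with actions $u_1,u_2,\dots$ and the realized perturbations. For a sequence of actions, let $\hat x_t$ be the state reached if one artificially sets $x_{t-H+1}=0$ and simulates the system with the actions $u_{t-H+1},\dots,u_t$. The proxy loss, which depends only on the last $H$ actions, is $\ell_t(\mathbf 0,u_{t-H+1},\dots,u_t):=c_t(\hat x_t,u_t)$. **Bounded memory.** A sequence of actions $u_1,\dots,u_T$ is of $(H,\varepsilon)$-bounded memory if $|c_t(\hat x_t,u_t)-c_t(x_t,u_t)|\le\varepsilon$ for all $t$. Standing assumption: for the given system, the class of $(H,\varepsilon)$-bounded-memory sequences is closed under convex combination. **Policies.** $\Pi$ is a class of policies $\pi$, each mapping a sequence of perturbations $w_1,\dots,w_{t-1}$ to an action $u_t^\pi$. Standing assumption: the policies considered induce bounded memory, i.e. their action sequences are of $(H,\varepsilon)$-bounded memory. $\mathrm{conv}(\Pi)$ is the convex hull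 of $\Pi$ (policies playing a convex combination of the actions of policies in $\Pi$). **Smoothness.** A loss function $\ell$ of $H$ actions is $\beta$-smooth if for all $u_1,\dots,u_H$ and $\tilde u_1,\dots,\tilde u_H$, $$\ell(u_1,\dots,u_H)-\ell(\tilde u_1,\dots,\tilde u_H)\le\sum_{j=1}^H\nabla_j\ell(\tilde u_1,\dots,\tilde u_H)^\top(u_j-\tilde u_j)+\frac{\beta}{2}\sum_{j}\|u_j-\tilde u_j\|_2^2 ,$$ where $\nabla_j$ is the gradient in the $j$-th action. For the losses $\ell_t$ this refers to the proxy loss as a function of its $H$ actions. **Weak controller.** An online learning algorithm $\mathcal A_i$ for the system and reference class $\Pi$ (its output at round $t$ is written $\mathcal A_i(x_t)$ and is computed from its internal state) is a weak controller with respect to a class $\mathcal L$ of losses if: (1) the sequence of actions it produces is of $(H,\varepsilon)$-bounded memory; (2) when run with losses $\ell_t^i\in\mathcal L$ it produces actions $u_1,\dots,u_T$ with $$\sum_{t=1}^T \ell_t^i(u_1,\dots,u_t)-\min_{\pi\in\Pi}\sum_{t=1}^T \ell_t^i(u_1^\pi,\dots,u_t^\pi)\le R(T),$$ where $R(T)$ is a non-decreasing sublinear function of $T$. The truncated-memory guarantee assumed in the claim is that, for the losses $\ell_t^i$ of the $H$ most recent actions passed to $\mathcal A_i$ and its own actions $u_t$, $$\sum_{t=1}^T \ell_t^i(u_{t-H+1},\dots,u_t)-\min_{\pi\in\Pi}\sum_{t=1}^T \ell_t^i(u_{t-H+1}^\pi,\dots,u_t^\pi)\le R(T)+2T\varepsilon.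 \qquad (∗)$$ **DynaBoost1.** Set $\eta_i=\frac{2}{i+1}$ for $i\in[N]$. At each round $t=1,\dots,T$: receive $x_t$; put $u_t^0=\mathbf 0$ and, for $i=1,\dots,N$, $u_t^i=(1-\eta_i)u_t^{i-1}+\eta_i\mathcal A_i(x_t)$; output $u_t=u_t^N$; receive $\ell_t$ and suffer $\ell_t(u_1,\dots,u_t)$; for each $i\in[N]$ pass to $\mathcal A_i$ the linear loss $$\ell_t^i(v_1,\dots,v_H)=\sum_{j=1}^H\nabla_j^\top v_j,$$ where $\nabla_j$ is the gradient of $\ell_t(\mathbf 0,u_{t-H+1}^{i-1},\dots,u_t^{i-1})$ with respect to the action at time $t-H+j$.
   Formalization: The proxy losses are assumed convex in the H actions on U (convexity of c_t alone does not suffice for general dynamics f, and the bound then fails), and 0 is assumed to belong to U, since the algorithm starts from the action 0. *)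

theory Defs
  imports "HOL-Analysis.Analysis" "HOL-Library.Landau_Symbols"
begin

text \<open>Rounds are numbered from 1, so entry 0 of a sequence of states, actions, perturbations or
  losses is never read. A loss of \<open>H\<close> actions is a function of \<open>v :: nat \<Rightarrow> 'u\<close> of which only
  \<open>v 1, \<dots>, v H\<close> matter.\<close>

section \<open>The system and its losses\<close>

primrec state_at ::
  "('x \<Rightarrow> 'u \<Rightarrow> 'x) \<Rightarrow> 'x \<Rightarrow> (nat \<Rightarrow> 'x) \<Rightarrow> (nat \<Rightarrow> 'u) \<Rightarrow> nat \<Rightarrow> 'x::real_vector" where
  "state_at f x\<^sub>1 w u 0 = x\<^sub>1"
| "state_at f x\<^sub>1 w u (Suc t) = (if t = 0 then x\<^sub>1 else f (state_at f x\<^sub>1 w u t) (u t) + w t)"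

definition full_loss ::
  "('x \<Rightarrow> 'u \<Rightarrow> 'x) \<Rightarrow> 'x::real_vector \<Rightarrow> (nat \<Rightarrow> 'x) \<Rightarrow> (nat \<Rightarrow> 'x \<Rightarrow> 'u \<Rightarrow> real) \<Rightarrow> nat
    \<Rightarrow> (nat \<Rightarrow> 'u) \<Rightarrow> real" where
  "full_loss f x\<^sub>1 w c t u = c t (state_at f x\<^sub>1 w u t) (u t)"

text \<open>The window \<open>z\<^bsub>t-H+1\<^esub>, \<dots>, z\<^sub>t\<close>, its entries indexed \<open>1, \<dots>, H\<close>. In the first rounds the
  window reaches back before round 1; these missing actions and perturbations are taken to be zero.\<close>

definition window :: "nat \<Rightarrow> (nat \<Rightarrow> 'a::zero) \<Rightarrow> nat \<Rightarrow> nat \<Rightarrow> 'a" where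
  "window H z t j = (if H < t + j then z (t + j - H) else 0)"

text \<open>The simulated state of round \<open>t\<close> is the \<open>H\<close>-th state of the same system, started in
  state 0 and perturbed by the last \<open>H\<close> perturbations.\<close>

definition proxy_loss ::
  "('x \<Rightarrow> 'u \<Rightarrow> 'x) \<Rightarrow> (nat \<Rightarrow> 'x::real_vector) \<Rightarrow> (nat \<Rightarrow> 'x \<Rightarrow> 'u \<Rightarrow> real) \<Rightarrow> nat \<Rightarrow> nat
    \<Rightarrow> (nat \<Rightarrow> 'u) \<Rightarrow> real" where
  "proxy_loss f w c H t v = c t (state_at f 0 (window H w t) v H) (v H)"

definition bounded_memory ::
  "('x \<Rightarrow> 'u \<Rightarrow> 'x) \<Rightarrow> 'x::real_vector \<Rightarrow> (nat \<Rightarrow> 'x) \<Rightarrow> (nat \<Rightarrow> 'x \<Rightarrow> 'u \<Rightarrow> real) \<Rightarrow> 'u set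
    \<Rightarrow> nat \<Rightarrow> real \<Rightarrow> nat \<Rightarrow> (nat \<Rightarrow> 'u::zero) set" where
  "bounded_memory f x\<^sub>1 w c U H \<epsilon> T =
    {u. \<forall>t\<in>{1..T}. u t \<in> U \<and>
          \<bar>proxy_loss f w c H t (window H u t) - full_loss f x\<^sub>1 w c t u\<bar> \<le> \<epsilon>}"

text \<open>Convexity of a set of sequences, which do not form a \<^class>\<open>real_vector\<close> type.\<close>

definition convex_combination_closed :: "(nat \<Rightarrow> 'u::real_vector) set \<Rightarrow> bool" where
  "convex_combination_closed S \<longleftrightarrow>
    (\<forall>u\<in>S. \<forall>v\<in>S. \<forall>a\<in>{0..1::real}. (\<lambda>t. (1 - a) *\<^sub>R u t + a *\<^sub>R v t) \<in> S)"

section \<open>Classes of losses of H actions\<close>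

definition tuples :: "nat \<Rightarrow> 'u set \<Rightarrow> (nat \<Rightarrow> 'u) set" where
  "tuples H U = {v. \<forall>j\<in>{1..H}. v j \<in> U}"

text \<open>The gradient in the \<open>j\<close>-th action.\<close>

definition grad :: "nat \<Rightarrow> ((nat \<Rightarrow> 'u) \<Rightarrow> real) \<Rightarrow> (nat \<Rightarrow> 'u) \<Rightarrow> 'u::real_inner" where
  "grad j l v = (THE g. GDERIV (\<lambda>y. l (v(j := y))) (v j) :> g)"

text \<open>Frechet differentiability jointly in the \<open>H\<close> actions, spelled out because
  \<open>nat \<Rightarrow> 'u\<close> is not a normed space.\<close>

definition tuple_differentiable ::
  "nat \<Rightarrow> ((nat \<Rightarrow> 'u) \<Rightarrow> real) \<Rightarrow> (nat \<Rightarrow> 'u::real_inner) \<Rightarrow> bool" where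
  "tuple_differentiable H l v \<longleftrightarrow>
    (\<exists>g. \<forall>e>0. \<exists>\<delta>>0. \<forall>y. (\<forall>j\<in>{1..H}. norm (y j - v j) < \<delta>) \<longrightarrow>
       \<bar>l y - l v - (\<Sum>j=1..H. g j \<bullet> (y j - v j))\<bar> \<le> e * (\<Sum>j=1..H. norm (y j - v j)))"

definition smooth_losses ::
  "nat \<Rightarrow> 'u set \<Rightarrow> real \<Rightarrow> ((nat \<Rightarrow> 'u::real_inner) \<Rightarrow> real) set" where
  "smooth_losses H U \<beta> =
    {l. \<forall>v\<in>tuples H U. tuple_differentiable H l v \<and>
         (\<forall>u\<in>tuples H U.
            l u - l v \<le> (\<Sum>j=1..H. grad j l v \<bullet> (u j - v j))
                       + \<beta> / 2 * (\<Sum>j=1..H. (norm (u j - v j))\<^sup>2))}"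

definition convex_losses :: "nat \<Rightarrow> 'u set \<Rightarrow> ((nat \<Rightarrow> 'u::real_vector) \<Rightarrow> real) set" where
  "convex_losses H U =
    {l. \<forall>u\<in>tuples H U. \<forall>v\<in>tuples H U. \<forall>a\<in>{0..1::real}.
         l (\<lambda>j. (1 - a) *\<^sub>R u j + a *\<^sub>R v j) \<le> (1 - a) * l u + a * l v}"

definition linear_losses :: "nat \<Rightarrow> ((nat \<Rightarrow> 'u::real_inner) \<Rightarrow> real) set" where
  "linear_losses H = {l. \<exists>g. l = (\<lambda>v. \<Sum>j=1..H. g j \<bullet> v j)}"

definition gradient_loss ::
  "nat \<Rightarrow> ((nat \<Rightarrow> 'u) \<Rightarrow> real) \<Rightarrow> (nat \<Rightarrow> 'u) \<Rightarrow> (nat \<Rightarrow> 'u::real_inner) \<Rightarrow> real" where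
  "gradient_loss H l u = (\<lambda>v. \<Sum>j=1..H. grad j l u \<bullet> v j)"

section \<open>Policies\<close>

type_synonym ('x, 'u) policy = "'x list \<Rightarrow> 'u"

definition policy_actions :: "('x, 'u) policy \<Rightarrow> (nat \<Rightarrow> 'x) \<Rightarrow> nat \<Rightarrow> 'u" where
  "policy_actions \<pi> w t = \<pi> (map w [1..<t])"

definition conv_policies :: "('x, 'u::real_vector) policy set \<Rightarrow> ('x, 'u) policy set" where
  "conv_policies P =
    {(\<lambda>ws. \<Sum>\<pi>\<in>S. a \<pi> *\<^sub>R \<pi> ws) | S a.
       finite S \<and> S \<subseteq> P \<and> (\<forall>\<pi>\<in>S. 0 \<le> a \<pi>) \<and> sum a S = (1::real)}"

section \<open>Online controllers\<close>

text \<open>A controller is a state machine. In each round it sees the current state of the system and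
  outputs an action; then the perturbation and the loss of the round are revealed to it and
  \<open>step s x w l\<close> is its next internal state.\<close>

record ('s, 'x, 'u) controller =
  start :: 's
  act :: "'s \<Rightarrow> 'x \<Rightarrow> 'u"
  step :: "'s \<Rightarrow> 'x \<Rightarrow> 'x \<Rightarrow> ((nat \<Rightarrow> 'u) \<Rightarrow> real) \<Rightarrow> 's"

primrec internal_state ::
  "('s, 'x, 'u) controller \<Rightarrow> (nat \<Rightarrow> 'x) \<Rightarrow> (nat \<Rightarrow> 'x) \<Rightarrow> (nat \<Rightarrow> (nat \<Rightarrow> 'u) \<Rightarrow> real)
    \<Rightarrow> nat \<Rightarrow> 's" where
  "internal_state A x w l 0 = start A"
| "internal_state A x w l (Suc t) =
     step A (internal_state A x w l t) (x (Suc t)) (w (Suc t)) (l (Suc t))"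

text \<open>The actions that \<open>A\<close> proposes when it is shown the states \<open>x\<close>, which need not result from
  these actions.\<close>

definition outputs ::
  "('s, 'x, 'u) controller \<Rightarrow> (nat \<Rightarrow> 'x) \<Rightarrow> (nat \<Rightarrow> 'x) \<Rightarrow> (nat \<Rightarrow> (nat \<Rightarrow> 'u) \<Rightarrow> real)
    \<Rightarrow> nat \<Rightarrow> 'u" where
  "outputs A x w l t = act A (internal_state A x w l (t - 1)) (x t)"

text \<open>Closed loop: the internal state of \<open>B\<close> and the state of the system after \<open>t\<close> rounds in which
  the actions of \<open>B\<close> are carried out.\<close>

primrec closed_loop ::
  "('x \<Rightarrow> 'u \<Rightarrow> 'x) \<Rightarrow> 'x \<Rightarrow> (nat \<Rightarrow> 'x) \<Rightarrow> (nat \<Rightarrow> (nat \<Rightarrow> 'u) \<Rightarrow> real)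
    \<Rightarrow> ('s, 'x, 'u) controller \<Rightarrow> nat \<Rightarrow> 's \<times> 'x::real_vector" where
  "closed_loop f x\<^sub>1 w l B 0 = (start B, x\<^sub>1)"
| "closed_loop f x\<^sub>1 w l B (Suc t) =
    (case closed_loop f x\<^sub>1 w l B t of (s, x) \<Rightarrow>
       (step B s x (w (Suc t)) (l (Suc t)), f x (act B s x) + w (Suc t)))"

definition closed_loop_actions ::
  "('x \<Rightarrow> 'u \<Rightarrow> 'x) \<Rightarrow> 'x \<Rightarrow> (nat \<Rightarrow> 'x) \<Rightarrow> (nat \<Rightarrow> (nat \<Rightarrow> 'u) \<Rightarrow> real)
    \<Rightarrow> ('s, 'x::real_vector, 'u) controller \<Rightarrow> nat \<Rightarrow> 'u" where
  "closed_loop_actions f x\<^sub>1 w l B t =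
    (case closed_loop f x\<^sub>1 w l B (t - 1) of (s, x) \<Rightarrow> act B s x)"

text \<open>A weak controller for the class \<open>L\<close> of losses of \<open>H\<close> actions, with the truncated-memory
  regret guarantee. The states it observes are those of a system that may be driven by other
  actions \<open>v\<close> than its own, which is how a booster uses it. The minimum over \<open>P\<close> is rendered as an
  infimum.\<close>

definition weak_controller ::
  "('x \<Rightarrow> 'u \<Rightarrow> 'x) \<Rightarrow> 'x \<Rightarrow> (nat \<Rightarrow> 'x) \<Rightarrow> (nat \<Rightarrow> 'x \<Rightarrow> 'u \<Rightarrow> real) \<Rightarrow> 'u set
    \<Rightarrow> nat \<Rightarrow> real \<Rightarrow> nat \<Rightarrow> ('x, 'u) policy set \<Rightarrow> ((nat \<Rightarrow> 'u) \<Rightarrow> real) set \<Rightarrow> (nat \<Rightarrow> real)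
    \<Rightarrow> ('s, 'x::real_vector, 'u::real_vector) controller \<Rightarrow> bool" where
  "weak_controller f x\<^sub>1 w c U H \<epsilon> T P L R A \<longleftrightarrow>
    mono R \<and> R \<in> o(\<lambda>n. real n) \<and>
    (\<forall>s x. act A s x \<in> U) \<and>
    (\<forall>v l. (\<forall>t\<in>{1..T}. v t \<in> U) \<longrightarrow> (\<forall>t\<in>{1..T}. l t \<in> L) \<longrightarrow>
      (let u = outputs A (state_at f x\<^sub>1 w v) w l in
         u \<in> bounded_memory f x\<^sub>1 w c U H \<epsilon> T \<and>
         (\<Sum>t=1..T. l t (window H u t))
           - (INF \<pi>\<in>P. \<Sum>t=1..T. l t (window H (policy_actions \<pi> w) t))
           \<le> R T + 2 * real T * \<epsilon>))"

section \<open>The boosting algorithm\<close>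

primrec boost_iterate :: "(nat \<Rightarrow> 'u) \<Rightarrow> nat \<Rightarrow> 'u::real_vector" where
  "boost_iterate a 0 = 0"
| "boost_iterate a (Suc i) =
    (let \<eta> = 2 / (real (Suc i) + 1)
     in (1 - \<eta>) *\<^sub>R boost_iterate a i + \<eta> *\<^sub>R a (Suc i))"

text \<open>DynaBoost1 is itself a controller. Its internal state \<open>(q, h, n)\<close> consists of the internal
  states \<open>q i\<close> of the copies \<open>i = 1, \<dots>, N\<close> of \<open>A\<close>, the iterates \<open>h s i\<close> of the past rounds
  \<open>s = 1, \<dots>, n\<close>, and the number \<open>n\<close> of past rounds. The loss it receives after a round is the loss
  of the last \<open>H\<close> actions. Copies \<open>i\<close> outside \<open>{1..N}\<close> have no influence on its actions.\<close>

definition dynaboost1 ::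
  "nat \<Rightarrow> nat \<Rightarrow> ('s, 'x, 'u::real_inner) controller
    \<Rightarrow> ((nat \<Rightarrow> 's) \<times> (nat \<Rightarrow> nat \<Rightarrow> 'u) \<times> nat, 'x, 'u) controller" where
  "dynaboost1 H N A =
    \<lparr>start = (\<lambda>i. start A, \<lambda>s i. 0, 0),
     act = (\<lambda>(q, h, n) x. boost_iterate (\<lambda>i. act A (q i) x) N),
     step = (\<lambda>(q, h, n) x w l.
       let t = Suc n;
           h' = h(t := boost_iterate (\<lambda>i. act A (q i) x))
       in (\<lambda>i. step A (q i) x w (gradient_loss H l (window H (\<lambda>s. h' s (i - 1)) t)), h', t))\<rparr>"

end

theory Submission
  imports Defs
begin

text \<open>Across the copies \<open>i = 1, \<dots>, N\<close>, DynaBoost1 runs the Frank-Wolfe method on the sum of the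
  proxy losses, and the regret guarantee of copy \<open>i\<close> says that its actions solve the \<open>i\<close>-th linear
  subproblem up to \<open>\<rho> = R(T) + 2T\<epsilon>\<close>. With \<open>\<eta>\<^sub>i = 2/(i+1)\<close> the gap \<open>\<Delta>\<^sub>i\<close> to a comparator satisfies
  \<open>\<Delta>\<^sub>i \<le> (1 - \<eta>\<^sub>i) \<Delta>\<^bsub>i-1\<^esub> + \<eta>\<^sub>i \<rho> + \<eta>\<^sub>i\<^sup>2 \<beta>HD\<^sup>2T/2\<close>, hence \<open>\<Delta>\<^sub>N \<le> 2\<beta>HD\<^sup>2T/N + \<rho>\<close>. Bounded memory turns
  proxy losses into true losses at a cost of \<open>T\<epsilon>\<close> for each of the booster and the comparator.\<close>

section \<open>Gradients of losses of \<open>H\<close> actions\<close>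

text \<open>The linear term and the error bound involve only entries \<open>1, ..., H\<close>, so
  both vanish when these agree. This lets the window recorded by the algorithm be exchanged for the
  true one.\<close>

lemma tuple_differentiable_cong:
  assumes "tuple_differentiable H l v" and "\<And>j. j \<in> {1..H} \<Longrightarrow> y j = v j"
  shows "l y = l v"
proof -
  obtain g where g: "\<forall>e>0. \<exists>\<delta>>0. \<forall>y. (\<forall>j\<in>{1..H}. norm (y j - v j) < \<delta>) \<longrightarrow>
      \<bar>l y - l v - (\<Sum>j=1..H. g j \<bullet> (y j - v j))\<bar> \<le> e * (\<Sum>j=1..H. norm (y j - v j))"
    using assms(1) unfolding tuple_differentiable_def by blast
  then obtain \<delta> where "\<delta> > 0" "(\<forall>j\<in>{1..H}. norm (y j - v j) < \<delta>) \<longrightarrow>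
      \<bar>l y - l v - (\<Sum>j=1..H. g j \<bullet> (y j - v j))\<bar> \<le> 1 * (\<Sum>j=1..H. norm (y j - v j))"
    using zero_less_one by blast
  with assms(2) show ?thesis by simp
qed

text \<open>Varying a single action collapses both sums to one term, so a joint derivative is in
  particular a partial one; uniqueness of derivatives then resolves the \<open>THE\<close> in
  \<open>grad\<close>.\<close>

lemma grad_eqI:
  assumes g: "\<forall>e>0. \<exists>\<delta>>0. \<forall>y. (\<forall>j\<in>{1..H}. norm (y j - v j) < \<delta>) \<longrightarrow>
      \<bar>l y - l v - (\<Sum>j=1..H. g j \<bullet> (y j - v j))\<bar> \<le> e * (\<Sum>j=1..H. norm (y j - v j))"
    and j: "j \<in> {1..H}"
  shows "grad j l v = g j"
proof -
  have single: "(\<Sum>i=1..H. if i = j then r else 0) = r" for r :: real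
    using j by (simp add: sum.delta)
  have inner_sum: "(\<Sum>i=1..H. g i \<bullet> ((v(j := y)) i - v i)) = g j \<bullet> (y - v j)" for y
    by (subst single[symmetric]) (rule sum.cong, auto)
  have norm_sum: "(\<Sum>i=1..H. norm ((v(j := y)) i - v i)) = norm (y - v j)" for y
    by (subst single[symmetric]) (rule sum.cong, auto)
  have deriv: "GDERIV (\<lambda>y. l (v(j := y))) (v j) :> g j"
    unfolding gderiv_def has_derivative_at_alt
  proof (intro conjI allI impI)
    show "bounded_linear (\<lambda>h. h \<bullet> g j)" by (rule bounded_linear_inner_left)
    fix e :: real assume "0 < e"
    with g obtain \<delta> where \<delta>: "\<delta> > 0" "\<And>y. (\<forall>j\<in>{1..H}. norm (y j - v j) < \<delta>) \<Longrightarrow>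
        \<bar>l y - l v - (\<Sum>j=1..H. g j \<bullet> (y j - v j))\<bar> \<le> e * (\<Sum>j=1..H. norm (y j - v j))"
      by blast
    show "\<exists>d>0. \<forall>y. norm (y - v j) < d \<longrightarrow>
        norm (l (v(j := y)) - l (v(j := v j)) - (y - v j) \<bullet> g j) \<le> e * norm (y - v j)"
    proof (intro exI[of _ \<delta>] conjI allI impI \<delta>(1))
      fix y assume "norm (y - v j) < \<delta>"
      then have "\<forall>i\<in>{1..H}. norm ((v(j := y)) i - v i) < \<delta>" using \<delta>(1) by simp
      from \<delta>(2)[of "v(j := y)", OF this] show
        "norm (l (v(j := y)) - l (v(j := v j)) - (y - v j) \<bullet> g j) \<le> e * norm (y - v j)"
        unfolding inner_sum norm_sum by (simp add: inner_commute)
    qed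
  qed
  show ?thesis unfolding grad_def
  proof (rule the_equality, rule deriv)
    fix g' assume "GDERIV (\<lambda>y. l (v(j := y))) (v j) :> g'"
    then have "(\<lambda>h. h \<bullet> g') = (\<lambda>h. h \<bullet> g j)"
      using deriv unfolding gderiv_def by (rule has_derivative_unique)
    then show "g' = g j" by (metis vector_eq_ldot)
  qed
qed

text \<open>On the segment from \<open>v\<close> to \<open>z\<close>, convexity bounds the increment
  of \<open>l\<close> from above, and differentiability at \<open>v\<close> bounds it from below by
  nearly its linear part. Dividing by the step length gives the first-order inequality.\<close>

lemma grad_inner_le_of_convex:
  assumes diff: "tuple_differentiable H l v" and conv: "l \<in> convex_losses H U"
    and v: "v \<in> tuples H U" and z: "z \<in> tuples H U"
  shows "(\<Sum>j=1..H. grad j l v \<bullet> (z j - v j)) \<le> l z - l v"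
proof -
  obtain g where g: "\<forall>e>0. \<exists>\<delta>>0. \<forall>y. (\<forall>j\<in>{1..H}. norm (y j - v j) < \<delta>) \<longrightarrow>
      \<bar>l y - l v - (\<Sum>j=1..H. g j \<bullet> (y j - v j))\<bar> \<le> e * (\<Sum>j=1..H. norm (y j - v j))"
    using diff unfolding tuple_differentiable_def by blast
  define G where "G = (\<Sum>j=1..H. g j \<bullet> (z j - v j))"
  define M where "M = (\<Sum>j=1..H. norm (z j - v j))"
  have M: "M \<ge> 0" unfolding M_def by (rule sum_nonneg) simp
  have norm_le: "norm (z j - v j) \<le> M" if "j \<in> {1..H}" for j
    unfolding M_def using that by (intro member_le_sum) auto
  have "G \<le> l z - l v + e" if e: "e > 0" for e
  proof -
    \<comment> \<open>Using \<open>M + 1\<close> in place of \<open>M\<close> keeps the tolerance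
      positive even if \<open>M = 0\<close>.\<close>
    have "e / (M + 1) > 0" using e M by simp
    with g obtain \<delta> where \<delta>: "\<delta> > 0" "\<And>y. (\<forall>j\<in>{1..H}. norm (y j - v j) < \<delta>) \<Longrightarrow>
        \<bar>l y - l v - (\<Sum>j=1..H. g j \<bullet> (y j - v j))\<bar> \<le> e / (M + 1) * (\<Sum>j=1..H. norm (y j - v j))"
      by blast
    \<comment> \<open>The step stays on the segment and moves every action by less than
      \<open>\<delta>\<close>; the factor 1/2 makes this strict.\<close>
    define s where "s = min 1 (\<delta> / (M + 1) / 2)"
    have "s * (M + 1) \<le> \<delta> / (M + 1) / 2 * (M + 1)"
      using M by (intro mult_right_mono) (auto simp: s_def)
    also have "\<dots> = \<delta> / 2" using M by (simp add: field_simps)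
    also have "\<dots> < \<delta>" using \<delta>(1) by simp
    finally have s: "0 < s" "s \<le> 1" "s * (M + 1) < \<delta>"
      using \<delta>(1) M by (auto simp: s_def)
    define y where "y = (\<lambda>j. (1 - s) *\<^sub>R v j + s *\<^sub>R z j)"
    have y: "y j - v j = s *\<^sub>R (z j - v j)" for j
      by (simp add: y_def algebra_simps)
    have "\<forall>j\<in>{1..H}. norm (y j - v j) < \<delta>"
    proof
      fix j assume "j \<in> {1..H}"
      from norm_le[OF this] have "s * norm (z j - v j) \<le> s * (M + 1)"
        using s by (intro mult_left_mono) auto
      moreover have "norm (y j - v j) = s * norm (z j - v j)" using s by (simp add: y)
      ultimately show "norm (y j - v j) < \<delta>" using s(3) by linarith
    qed
    from \<delta>(2)[OF this] have "\<bar>l y - l v - s * G\<bar> \<le> e / (M + 1) * (s * M)"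
      using s by (simp add: y G_def M_def sum_distrib_left)
    moreover have "e / (M + 1) * (s * M) \<le> s * e"
      using s e M by (simp add: field_simps)
    moreover have "l y \<le> (1 - s) * l v + s * l z"
      using conv v z s unfolding convex_losses_def y_def by auto
    ultimately have "s * G \<le> s * (l z - l v + e)"
      by (simp add: algebra_simps)
    then show ?thesis using s by simp
  qed
  then have "G \<le> l z - l v" by (rule field_le_epsilon)
  moreover have "(\<Sum>j=1..H. grad j l v \<bullet> (z j - v j)) = G"
    unfolding G_def using grad_eqI[OF g] by (intro sum.cong) auto
  ultimately show ?thesis by simp
qed

section \<open>One Frank-Wolfe step and its recurrence\<close>

text \<open>Smoothness at \<open>v\<close> bounds \<open>l u\<close>, with linear term
  \<open>\<eta>\<close> times the slope towards \<open>a\<close>. Splitting this slope at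
  \<open>z\<close> leaves a difference of linear losses and a slope towards \<open>z\<close>, which
  convexity bounds by \<open>l z - l v\<close>. In the quadratic term each action moves by at most
  \<open>\<eta> * diameter U\<close>.\<close>

lemma frank_wolfe_step:
  assumes smooth: "l \<in> smooth_losses H U \<beta>" and conv: "l \<in> convex_losses H U"
    and U: "bounded U" and \<beta>: "0 \<le> \<beta>" and \<eta>: "0 \<le> \<eta>"
    and v: "v \<in> tuples H U" and a: "a \<in> tuples H U" and z: "z \<in> tuples H U" and u: "u \<in> tuples H U"
    and u_eq: "\<And>j. j \<in> {1..H} \<Longrightarrow> u j = (1 - \<eta>) *\<^sub>R v j + \<eta> *\<^sub>R a j"
  shows "l u - l z \<le> (1 - \<eta>) * (l v - l z) + \<eta> * (gradient_loss H l v a - gradient_loss H l v z)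
    + \<eta>\<^sup>2 * (\<beta> * real H * (diameter U)\<^sup>2 / 2)"
proof -
  have step: "u j - v j = \<eta> *\<^sub>R (a j - v j)" if "j \<in> {1..H}" for j
    using u_eq[OF that] by (simp add: algebra_simps)
  have "(\<Sum>j=1..H. grad j l v \<bullet> (u j - v j)) = (\<Sum>j=1..H. \<eta> * (grad j l v \<bullet> (a j - v j)))"
    by (rule sum.cong) (auto simp: step)
  also have "\<dots> = \<eta> * (gradient_loss H l v a - gradient_loss H l v z
      + (\<Sum>j=1..H. grad j l v \<bullet> (z j - v j)))"
    by (simp add: gradient_loss_def inner_diff_right sum_distrib_left[symmetric] sum_subtractf)
  also have "\<dots> \<le> \<eta> * (gradient_loss H l v a - gradient_loss H l v z + (l z - l v))"
    using grad_inner_le_of_convex[OF _ conv v z] smooth v \<eta>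
    by (intro mult_left_mono add_left_mono) (auto simp: smooth_losses_def)
  finally have first: "(\<Sum>j=1..H. grad j l v \<bullet> (u j - v j))
      \<le> \<eta> * (gradient_loss H l v a - gradient_loss H l v z + (l z - l v))" .
  have "(\<Sum>j=1..H. (norm (u j - v j))\<^sup>2) \<le> (\<Sum>j=1..H. \<eta>\<^sup>2 * (diameter U)\<^sup>2)"
  proof (rule sum_mono)
    fix j assume j: "j \<in> {1..H}"
    then have "norm (a j - v j) \<le> diameter U"
      using diameter_bounded_bound[OF U, of "a j" "v j"] a v by (auto simp: tuples_def dist_norm)
    then show "(norm (u j - v j))\<^sup>2 \<le> \<eta>\<^sup>2 * (diameter U)\<^sup>2"
      by (simp add: step[OF j] power_mult_distrib power_mono mult_left_mono)
  qed
  then have "\<beta> / 2 * (\<Sum>j=1..H. (norm (u j - v j))\<^sup>2) \<le> \<beta> / 2 * (real H * (\<eta>\<^sup>2 * (diameter U)\<^sup>2))"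
    using \<beta> by (intro mult_left_mono) auto
  moreover have "l u - l v \<le> (\<Sum>j=1..H. grad j l v \<bullet> (u j - v j))
      + \<beta> / 2 * (\<Sum>j=1..H. (norm (u j - v j))\<^sup>2)"
    using smooth u v unfolding smooth_losses_def by blast
  ultimately show ?thesis using first by (simp add: algebra_simps)
qed

text \<open>The first step size is 1, so \<open>\<Delta> 0\<close> drops out and the bound starts at
  index 1; from there it reproduces itself.\<close>

lemma frank_wolfe_recurrence:
  fixes \<Delta> :: "nat \<Rightarrow> real"
  assumes rec: "\<And>i. \<Delta> (Suc i) \<le> (1 - 2 / (real (Suc i) + 1)) * \<Delta> i
      + 2 / (real (Suc i) + 1) * \<rho> + (2 / (real (Suc i) + 1))\<^sup>2 * K"
    and K: "0 \<le> K"
  shows "\<Delta> (Suc i) \<le> 4 * K / (real (Suc i) + 1) + \<rho>"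
proof (induction i)
  case 0
  then show ?case using rec[of 0] K by simp
next
  case (Suc i)
  define m where "m = real i + 2"
  have m: "m > 1" and ms: "real (Suc i) + 1 = m" "real (Suc (Suc i)) + 1 = m + 1"
    by (auto simp: m_def)
  have "\<Delta> (Suc (Suc i)) \<le> (1 - 2 / (m + 1)) * \<Delta> (Suc i) + 2 / (m + 1) * \<rho> + (2 / (m + 1))\<^sup>2 * K"
    using rec[of "Suc i"] unfolding ms .
  also have "\<dots> \<le> (1 - 2 / (m + 1)) * (4 * K / m + \<rho>) + 2 / (m + 1) * \<rho> + (2 / (m + 1))\<^sup>2 * K"
    using Suc.IH m unfolding ms by (intro add_right_mono mult_left_mono) auto
  \<comment> \<open>The \<open>\<rho>\<close> terms merge because their weights sum to 1, and
    \<open>1 - 2 / (m + 1) = (m - 1) / (m + 1)\<close>. The bracket equals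
    \<open>1 - 1 / m + 1 / (m + 1)\<close>, hence is at most 1.\<close>
  also have "\<dots> = 4 * K / (m + 1) * ((m - 1) / m + 1 / (m + 1)) + \<rho>"
  proof -
    have "(1 - 2 / (m + 1)) * (4 * K / m) = 4 * K / (m + 1) * ((m - 1) / m)"
      using m by (simp add: field_simps)
    then show ?thesis
      by (simp add: distrib_left power2_eq_square) (simp add: algebra_simps)
  qed
  also have "\<dots> \<le> 4 * K / (m + 1) * 1 + \<rho>"
    using m K by (intro add_right_mono mult_left_mono) (auto simp: divide_simps, simp add: algebra_simps)
  finally show ?case unfolding ms by simp
qed

section \<open>Convex combinations, windows and linear losses\<close>

text \<open>Induction that splits off one element and renormalises the remaining weights, which
  reduces to the two-point case.\<close>

lemma convex_combination_closed_sum: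
  assumes closed: "convex_combination_closed B" and "finite S"
    and "\<And>p. p \<in> S \<Longrightarrow> 0 \<le> a p" "sum a S = 1" "\<And>p. p \<in> S \<Longrightarrow> y p \<in> B"
  shows "(\<lambda>t. \<Sum>p\<in>S. a p *\<^sub>R y p t) \<in> B"
  using assms(2-)
proof (induction S arbitrary: a rule: finite_induct)
  case empty
  then show ?case by simp
next
  case (insert p S)
  have sum_S: "sum a S = 1 - a p" using insert.prems insert.hyps by simp
  have nonneg: "\<And>p. p \<in> S \<Longrightarrow> 0 \<le> a p" using insert.prems by simp
  have "0 \<le> sum a S" using nonneg by (rule sum_nonneg)
  show ?case
  \<comment> \<open>Weight 1 leaves nothing to renormalise: all other weights vanish.\<close>
  proof (cases "a p = 1")
    case True
    then have "\<forall>q\<in>S. a q = 0" using sum_S nonneg insert.hyps by (simp add: sum_nonneg_eq_0_iff)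
    then have "(\<lambda>t. \<Sum>q\<in>insert p S. a q *\<^sub>R y q t) = y p"
      using True insert.hyps by (simp add: fun_eq_iff)
    then show ?thesis using insert.prems(3) by simp
  next
    case False
    define b where "b = 1 - a p"
    have b: "b > 0" "b \<le> 1"
      using False \<open>0 \<le> sum a S\<close> sum_S insert.prems(1)[of p] by (auto simp: b_def)
    have "(\<lambda>t. \<Sum>q\<in>S. (a q / b) *\<^sub>R y q t) \<in> B"
      using insert.prems b nonneg sum_S
      by (intro insert.IH) (auto simp: sum_divide_distrib[symmetric] b_def)
    then have "(\<lambda>t. (1 - b) *\<^sub>R y p t + b *\<^sub>R (\<Sum>q\<in>S. (a q / b) *\<^sub>R y q t)) \<in> B"
      using closed insert.prems(3)[of p] b unfolding convex_combination_closed_def by simp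
    moreover have "(\<lambda>t. (1 - b) *\<^sub>R y p t + b *\<^sub>R (\<Sum>q\<in>S. (a q / b) *\<^sub>R y q t))
        = (\<lambda>t. \<Sum>q\<in>insert p S. a q *\<^sub>R y q t)"
      using b insert.hyps by (simp add: fun_eq_iff scaleR_sum_right b_def)
    ultimately show ?thesis by simp
  qed
qed

lemma window_in_tuples:
  assumes "0 \<in> U" and "\<And>s. 1 \<le> s \<Longrightarrow> s \<le> t \<Longrightarrow> z s \<in> U"
  shows "window H z t \<in> tuples H U"
  using assms by (auto simp: window_def tuples_def)

lemma gradient_loss_convex_combination:
  assumes "\<And>t. z t = (\<Sum>p\<in>S. a p *\<^sub>R y p t)"
  shows "gradient_loss H l v (window H z t) = (\<Sum>p\<in>S. a p * gradient_loss H l v (window H (y p) t))"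
proof -
  \<comment> \<open>The padding zeros are preserved by linear combinations, so \<open>window\<close>
    commutes with them.\<close>
  have "window H z t j = (\<Sum>p\<in>S. a p *\<^sub>R window H (y p) t j)" for j
    by (simp add: window_def assms)
  then have "gradient_loss H l v (window H z t)
      = (\<Sum>j=1..H. \<Sum>p\<in>S. a p * (grad j l v \<bullet> window H (y p) t j))"
    by (simp add: gradient_loss_def inner_sum_right)
  also have "\<dots> = (\<Sum>p\<in>S. \<Sum>j=1..H. a p * (grad j l v \<bullet> window H (y p) t j))"
    by (rule sum.swap)
  finally show ?thesis by (simp add: gradient_loss_def sum_distrib_left)
qed

text \<open>Cauchy-Schwarz. The bound ensures that the infimum of linear losses over policies really
  is a lower bound.\<close>

lemma gradient_loss_bounded_below:
  assumes "\<And>u. u \<in> U \<Longrightarrow> norm u \<le> b"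
  shows "\<forall>y\<in>tuples H U. - (\<Sum>j=1..H. norm (grad j l v) * b) \<le> gradient_loss H l v y"
  unfolding gradient_loss_def sum_negf[symmetric]
proof (intro ballI sum_mono)
  fix y j assume "y \<in> tuples H U" "j \<in> {1..H}"
  then have "norm (grad j l v) * norm (y j) \<le> norm (grad j l v) * b"
    using assms by (intro mult_left_mono) (auto simp: tuples_def)
  with Cauchy_Schwarz_ineq2[of "grad j l v" "y j"]
  show "- (norm (grad j l v) * b) \<le> grad j l v \<bullet> y j" by linarith
qed

section \<open>Boosting iterates and the closed loop\<close>

lemma boost_iterate_in_convex:
  assumes "convex U" "0 \<in> U" "\<And>k. a k \<in> U"
  shows "boost_iterate a i \<in> U"
proof (induction i)
  case (Suc i)
  then show ?case using assms by (simp add: Let_def convexD_alt)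
qed (simp add: assms)

text \<open>The first step size is 1, so the zero sequence from which the iteration starts need not
  belong to \<open>B\<close>.\<close>

lemma boost_iterate_in_closed:
  assumes "convex_combination_closed B" "\<And>k. 1 \<le> k \<Longrightarrow> (\<lambda>t. a t k) \<in> B"
  shows "(\<lambda>t. boost_iterate (a t) (Suc i)) \<in> B"
proof (induction i)
  case 0
  then show ?case using assms(2)[of 1] by simp
next
  case (Suc i)
  define \<eta> where "\<eta> = 2 / (real (Suc (Suc i)) + 1)"
  have "\<eta> \<in> {0..1}" by (simp add: \<eta>_def)
  with Suc assms(2)[of "Suc (Suc i)"] assms(1)
  have "(\<lambda>t. (1 - \<eta>) *\<^sub>R boost_iterate (a t) (Suc i) + \<eta> *\<^sub>R a t (Suc (Suc i))) \<in> B"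
    unfolding convex_combination_closed_def by simp
  then show ?case by (subst boost_iterate.simps) (simp only: \<eta>_def Let_def)
qed

text \<open>After \<open>t\<close> rounds the loop holds the state that is observed in round
  \<open>t + 1\<close>, which accounts for the shift. The action of that round is computed from
  exactly this pair, so both recursions make the same transition.\<close>

lemma closed_loop_state:
  "snd (closed_loop f x\<^sub>1 w l B t) = state_at f x\<^sub>1 w (closed_loop_actions f x\<^sub>1 w l B) (Suc t)"
proof (induction t)
  case (Suc t)
  obtain s x where C: "closed_loop f x\<^sub>1 w l B t = (s, x)" by fastforce
  have "act B s x = closed_loop_actions f x\<^sub>1 w l B (Suc t)"
    by (simp add: closed_loop_actions_def C)
  moreover have "x = state_at f x\<^sub>1 w (closed_loop_actions f x\<^sub>1 w l B) (Suc t)"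
    using Suc.IH C by simp
  ultimately show ?case
    by (subst state_at.simps) (simp add: C del: state_at.simps)
qed simp

text \<open>\<open>v i t\<close> and the window of iterates may differ at entries beyond \<open>H\<close>, because the algorithm has
  recorded 0 for future rounds; so they are equated only on \<open>{1..H}\<close>.\<close>

lemma dynaboost1_unroll:
  fixes A :: "('s, 'x::real_vector, 'u::real_inner) controller"
    and f :: "'x \<Rightarrow> 'u \<Rightarrow> 'x" and x\<^sub>1 :: 'x and w :: "nat \<Rightarrow> 'x"
    and l :: "nat \<Rightarrow> (nat \<Rightarrow> 'u) \<Rightarrow> real" and H N :: nat
  defines "u \<equiv> closed_loop_actions f x\<^sub>1 w l (dynaboost1 H N A)"
  shows "\<exists>a v.
    (\<forall>i. a i = outputs A (state_at f x\<^sub>1 w u) w (\<lambda>t. gradient_loss H (l t) (v i t))) \<and>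
    (\<forall>i t. \<forall>j\<in>{1..H}. v i t j = window H (\<lambda>s. boost_iterate (\<lambda>k. a k s) (i - 1)) t j) \<and>
    (\<forall>t. u t = boost_iterate (\<lambda>k. a k t) N)"
proof -
  \<comment> \<open>All objects are read off the closed loop, where the mutual dependence of
    \<open>u\<close>, the observed states and the proposals \<open>a\<close> is already resolved
    round by round.\<close>
  define x where "x = state_at f x\<^sub>1 w u"
  define C where "C = closed_loop f x\<^sub>1 w l (dynaboost1 H N A)"
  define q where "q t = fst (fst (C t))" for t
  define h where "h t = fst (snd (fst (C t)))" for t
  define a where "a i t = act A (q (t - 1) i) (x t)" for i t
  define v where "v i t = window H (\<lambda>s. h t s (i - 1)) t" for i t
  have C_state: "snd (C t) = x (Suc t)" for t
    unfolding C_def x_def u_def by (rule closed_loop_state)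
  have C_count: "snd (snd (fst (C t))) = t" for t
    by (induction t) (auto simp: C_def dynaboost1_def Let_def split: prod.splits)
  have C_eq: "C t = ((q t, h t, t), x (Suc t))" for t
    using C_state[of t] C_count[of t] by (simp add: q_def h_def prod_eq_iff)
  have C_Suc: "C (Suc t) = (step (dynaboost1 H N A) (q t, h t, t) (x (Suc t)) (w (Suc t)) (l (Suc t)),
      f (x (Suc t)) (act (dynaboost1 H N A) (q t, h t, t) (x (Suc t))) + w (Suc t))" for t
    using C_eq[of t] by (simp add: C_def)
  have h_Suc: "h (Suc t) = (h t)(Suc t := boost_iterate (\<lambda>k. a k (Suc t)))" for t
    using C_Suc[of t] by (simp add: h_def[of "Suc t"] dynaboost1_def Let_def a_def)
  have q_Suc: "q (Suc t) i = step A (q t i) (x (Suc t)) (w (Suc t))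
      (gradient_loss H (l (Suc t)) (v i (Suc t)))" for t i
    unfolding v_def h_Suc
    using C_Suc[of t] by (simp add: q_def[of "Suc t"] dynaboost1_def Let_def a_def)
  have q_0: "q 0 i = start A" for i
    by (simp add: q_def C_def dynaboost1_def)
  have q: "q t i = internal_state A x w (\<lambda>t. gradient_loss H (l t) (v i t)) t" for t i
    by (induction t) (simp_all add: q_0 q_Suc)
  \<comment> \<open>Each round writes only its own entry, so the record of round \<open>s\<close> is
    final from then on.\<close>
  have h: "h t s = boost_iterate (\<lambda>k. a k s)" if "1 \<le> s" "s \<le> t" for s t
    using that by (induction t) (auto simp: h_Suc le_Suc_eq)
  \<comment> \<open>At \<open>t = 0\<close> the subtraction truncates, but \<open>state_at\<close>
    equals \<open>x\<^sub>1\<close> at both 0 and 1.\<close>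
  have x_0: "x (Suc (t - 1)) = x t" for t
    by (cases t) (simp_all add: x_def)
  have u_eq: "u t = boost_iterate (\<lambda>k. a k t) N" for t
    unfolding u_def closed_loop_actions_def C_def[symmetric] C_eq x_0 a_def
    by (simp add: dynaboost1_def)
  have "a i = outputs A x w (\<lambda>t. gradient_loss H (l t) (v i t))" for i
    by (simp add: fun_eq_iff a_def outputs_def q)
  moreover have "v i t j = window H (\<lambda>s. boost_iterate (\<lambda>k. a k s) (i - 1)) t j"
    if "j \<in> {1..H}" for i t j
    using that by (auto simp: v_def window_def h)
  ultimately show ?thesis
    using u_eq unfolding x_def by blast
qed

section \<open>From policies to their convex hull\<close>

text \<open>For linear losses a mixture incurs the weighted average of the losses of its components,
  which is at least the infimum over \<open>P\<close>. Passing to the hull therefore costs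
  nothing.\<close>

lemma linear_regret_conv_policies:
  fixes U :: "'u::real_inner set"
  assumes U: "bounded U" "0 \<in> U" and P: "P \<noteq> {}" "\<forall>\<pi>\<in>P. \<forall>ws. \<pi> ws \<in> U"
    and reg: "r - (INF \<pi>\<in>P. \<Sum>t=1..T. gradient_loss H (l t) (v t) (window H (policy_actions \<pi> w) t)) \<le> \<rho>"
    and \<pi>: "\<pi> \<in> conv_policies P"
  shows "r - (\<Sum>t=1..T. gradient_loss H (l t) (v t) (window H (policy_actions \<pi> w) t)) \<le> \<rho>"
proof -
  define g where "g \<pi> = (\<Sum>t=1..T. gradient_loss H (l t) (v t) (window H (policy_actions \<pi> w) t))" for \<pi>
  from \<pi> obtain S a where S: "finite S" "S \<subseteq> P" "\<And>p. p \<in> S \<Longrightarrow> 0 \<le> a p" "sum a S = 1"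
    and \<pi>_eq: "\<pi> = (\<lambda>ws. \<Sum>p\<in>S. a p *\<^sub>R p ws)"
    unfolding conv_policies_def by blast
  obtain b where b: "\<And>u. u \<in> U \<Longrightarrow> norm u \<le> b"
    using U(1) unfolding bounded_iff by blast
  have "bdd_below (g ` P)"
  proof (rule bdd_belowI2)
    fix p assume "p \<in> P"
    then show "(\<Sum>t=1..T. - (\<Sum>j=1..H. norm (grad j (l t) (v t)) * b)) \<le> g p"
      unfolding g_def using P(2) U(2)
      by (intro sum_mono bspec[OF gradient_loss_bounded_below[OF b]] window_in_tuples)
        (auto simp: policy_actions_def)
  qed
  then have inf_le: "(INF p\<in>P. g p) \<le> g p" if "p \<in> S" for p
    using that S(2) by (intro cINF_lower) auto
  have "(INF p\<in>P. g p) = (\<Sum>p\<in>S. a p * (INF p\<in>P. g p))"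
    using S(4) by (simp add: sum_distrib_right[symmetric])
  also have "\<dots> \<le> (\<Sum>p\<in>S. a p * g p)"
    using S(3) inf_le by (intro sum_mono mult_left_mono)
  also have "\<dots> = (\<Sum>t=1..T. \<Sum>p\<in>S. a p * gradient_loss H (l t) (v t) (window H (policy_actions p w) t))"
    unfolding g_def sum_distrib_left by (rule sum.swap)
  also have "\<dots> = g \<pi>"
    unfolding g_def
    by (intro sum.cong refl gradient_loss_convex_combination[symmetric]) (simp add: policy_actions_def \<pi>_eq)
  finally show ?thesis using reg unfolding g_def by linarith
qed

section \<open>The regret bound for DynaBoost1\<close>

theorem theorem3p2:
  fixes f :: "real^'k \<Rightarrow> real^'d \<Rightarrow> real^'k"
    and x\<^sub>1 :: "real^'k"
    and U :: "(real^'d) set"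
    and w :: "nat \<Rightarrow> real^'k"
    and c :: "nat \<Rightarrow> real^'k \<Rightarrow> real^'d \<Rightarrow> real"
    and W \<beta> \<epsilon> :: real
    and H N T :: nat
    and P :: "(real^'k, real^'d) policy set"
    and L :: "((nat \<Rightarrow> real^'d) \<Rightarrow> real) set"
    and R :: "nat \<Rightarrow> real"
    and A :: "('s, real^'k, real^'d) controller"
  defines "proxy \<equiv> proxy_loss f w c H"
    and "loss \<equiv> full_loss f x\<^sub>1 w c"
    and "BM \<equiv> bounded_memory f x\<^sub>1 w c U H \<epsilon> T"
  assumes U: "convex U" "bounded U" "0 \<in> U"
    and params: "1 \<le> H" "1 \<le> N" "0 \<le> \<beta>"
    and perturbations: "\<forall>t\<in>{1..T}. norm (w t) \<le> W"
    and costs_convex: "\<forall>t\<in>{1..T}. convex_on (UNIV \<times> U) (\<lambda>(x, u). c t x u)"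
    and losses_convex: "\<forall>t\<in>{1..T}. proxy t \<in> convex_losses H U"
    and losses_smooth: "\<forall>t\<in>{1..T}. proxy t \<in> smooth_losses H U \<beta>"
    and memory_closed: "convex_combination_closed BM"
    and policies: "P \<noteq> {}" "\<forall>\<pi>\<in>P. \<forall>ws. \<pi> ws \<in> U" "\<forall>\<pi>\<in>P. policy_actions \<pi> w \<in> BM"
    and linear: "L \<subseteq> linear_losses H"
    and gradients: "\<forall>t\<in>{1..T}. \<forall>v\<in>tuples H U. gradient_loss H (proxy t) v \<in> L"
    and weak: "weak_controller f x\<^sub>1 w c U H \<epsilon> T P L R A"
  shows "let u = closed_loop_actions f x\<^sub>1 w proxy (dynaboost1 H N A) in
    (\<Sum>t=1..T. loss t u) - (INF \<pi>\<in>conv_policies P. \<Sum>t=1..T. loss t (policy_actions \<pi> w))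
      \<le> 2 * \<beta> * (diameter U)\<^sup>2 * real H * real T / real N + R T + 4 * real T * \<epsilon>"
proof -
  define B where "B = dynaboost1 H N A"
  define u where "u = closed_loop_actions f x\<^sub>1 w proxy B"
  define D where "D = diameter U"
  obtain a v where a: "\<And>i. a i = outputs A (state_at f x\<^sub>1 w u) w (\<lambda>t. gradient_loss H (proxy t) (v i t))"
    and v: "\<And>i t j. j \<in> {1..H} \<Longrightarrow>
       v i t j = window H (\<lambda>s. boost_iterate (\<lambda>k. a k s) (i - 1)) t j"
    and u: "\<And>t. u t = boost_iterate (\<lambda>k. a k t) N"
    using dynaboost1_unroll[of A f x\<^sub>1 w proxy H N] unfolding u_def B_def by blast
  \<comment> \<open>\<open>y i\<close> is the \<open>i\<close>-th Frank-Wolfe iterate as a sequence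
    over rounds; copy \<open>i\<close> is passed gradients taken at
    \<open>y (i - 1)\<close>.\<close>
  define y where "y i t = boost_iterate (\<lambda>k. a k t) i" for i t
  have a_U: "a i t \<in> U" for i t
    using weak by (simp add: a outputs_def weak_controller_def)
  have y_U: "y i t \<in> U" for i t
    unfolding y_def using U a_U by (intro boost_iterate_in_convex)
  have v_y: "v i t j = window H (y (i - 1)) t j" if "j \<in> {1..H}" for i t j
    using v[OF that] by (simp add: y_def[abs_def])
  have v_tuples: "v i t \<in> tuples H U" for i t
    using window_in_tuples[OF U(3), of t "y (i - 1)" H] y_U by (simp add: tuples_def v_y)
  have "a i \<in> BM \<and> (\<Sum>t=1..T. gradient_loss H (proxy t) (v i t) (window H (a i) t))
      - (INF \<pi>\<in>P. \<Sum>t=1..T. gradient_loss H (proxy t) (v i t) (window H (policy_actions \<pi> w) t))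
      \<le> R T + 2 * real T * \<epsilon>" for i
  proof -
    \<comment> \<open>Every copy observes the trajectory driven by the booster, so the guarantee is
      instantiated with driving actions \<open>u\<close>.\<close>
    have "\<forall>t\<in>{1..T}. u t \<in> U" using y_U u by (simp add: y_def)
    moreover have "\<forall>t\<in>{1..T}. gradient_loss H (proxy t) (v i t) \<in> L"
      using gradients v_tuples by blast
    ultimately show ?thesis
      unfolding a[of i] BM_def
      by (rule weak[unfolded weak_controller_def Let_def, THEN conjunct2, THEN conjunct2,
            THEN conjunct2, THEN spec[of _ u],
            THEN spec[of _ "\<lambda>t. gradient_loss H (proxy t) (v i t)"], THEN mp, THEN mp])
  qed
  then have a_BM: "a i \<in> BM" and regret:
    "(\<Sum>t=1..T. gradient_loss H (proxy t) (v i t) (window H (a i) t))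
      - (INF \<pi>\<in>P. \<Sum>t=1..T. gradient_loss H (proxy t) (v i t) (window H (policy_actions \<pi> w) t))
      \<le> R T + 2 * real T * \<epsilon>" for i
    by blast+
  have u_y: "u = y N" by (simp add: fun_eq_iff u y_def)
  have u_BM: "u \<in> BM"
    using boost_iterate_in_closed[OF memory_closed, of "\<lambda>t k. a k t" "N - 1"] a_BM params(2)
    by (simp add: u_y y_def[abs_def])
  have memory: "\<bar>proxy t (window H z t) - loss t z\<bar> \<le> \<epsilon>" if "z \<in> BM" "t \<in> {1..T}" for z t
    using that unfolding BM_def bounded_memory_def proxy_def loss_def by blast
  \<comment> \<open>With the constants moved to the left, all comparators share one lower bound,
    which then passes to the infimum.\<close>
  have bound: "(\<Sum>t=1..T. loss t u) - (2 * \<beta> * D\<^sup>2 * real H * real T / real N + R T + 4 * real T * \<epsilon>)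
      \<le> (\<Sum>t=1..T. loss t (policy_actions \<pi> w))" if \<pi>: "\<pi> \<in> conv_policies P" for \<pi>
  proof -
    define z where "z = policy_actions \<pi> w"
    from \<pi> obtain S b where S: "finite S" "S \<subseteq> P" "\<And>p. p \<in> S \<Longrightarrow> 0 \<le> b p" "sum b S = 1"
      and \<pi>_eq: "\<pi> = (\<lambda>ws. \<Sum>p\<in>S. b p *\<^sub>R p ws)"
      unfolding conv_policies_def by blast
    have z_eq: "z = (\<lambda>t. \<Sum>p\<in>S. b p *\<^sub>R policy_actions p w t)"
      by (simp add: z_def policy_actions_def[abs_def] \<pi>_eq)
    \<comment> \<open>The standing closure assumption carries bounded memory from \<open>P\<close>
      to mixtures.\<close>
    have z_BM: "z \<in> BM"
      unfolding z_eq using S policies(3) by (intro convex_combination_closed_sum[OF memory_closed]) auto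
    have z_U: "z t \<in> U" for t
      unfolding z_eq using S policies(2) U(1) by (intro convex_sum) (auto simp: policy_actions_def)
    define \<Delta> where "\<Delta> i = (\<Sum>t=1..T. proxy t (window H (y i) t) - proxy t (window H z t))" for i
    define \<rho> where "\<rho> = R T + 2 * real T * \<epsilon>"
    \<comment> \<open>The quadratic error of \<open>frank_wolfe_step\<close> without
      \<open>\<eta>\<^sup>2\<close>, summed over the \<open>T\<close> rounds.\<close>
    define K where "K = real T * (\<beta> * real H * D\<^sup>2 / 2)"
    have K: "0 \<le> K" using params(3) by (simp add: K_def)
    have "\<Delta> (Suc i) \<le> (1 - 2 / (real (Suc i) + 1)) * \<Delta> i
      + 2 / (real (Suc i) + 1) * \<rho> + (2 / (real (Suc i) + 1))\<^sup>2 * K" for i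
    proof -
      define \<eta> where "\<eta> = 2 / (real (Suc i) + 1)"
      have \<eta>: "0 \<le> \<eta>" by (simp add: \<eta>_def)
      let ?l = "\<lambda>t. gradient_loss H (proxy t) (v (Suc i) t)"
      have "\<Delta> (Suc i) \<le> (\<Sum>t=1..T. (1 - \<eta>) * (proxy t (window H (y i) t) - proxy t (window H z t))
          + \<eta> * (?l t (window H (a (Suc i)) t) - ?l t (window H z t)) + \<eta>\<^sup>2 * (\<beta> * real H * D\<^sup>2 / 2))"
        unfolding \<Delta>_def
      proof (rule sum_mono)
        fix t assume t: "t \<in> {1..T}"
        have smooth: "proxy t \<in> smooth_losses H U \<beta>" using losses_smooth t by blast
        then have "tuple_differentiable H (proxy t) (v (Suc i) t)"
          using v_tuples by (simp add: smooth_losses_def)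
        \<comment> \<open>The gradient is taken at the recorded window \<open>v (Suc i) t\<close>,
          whereas \<open>\<Delta> i\<close> speaks of the true window of \<open>y i\<close>.\<close>
        then have "proxy t (window H (y i) t) = proxy t (v (Suc i) t)"
          by (rule tuple_differentiable_cong) (simp add: v_y)
        moreover have "window H (y (Suc i)) t j
            = (1 - \<eta>) *\<^sub>R v (Suc i) t j + \<eta> *\<^sub>R window H (a (Suc i)) t j" if "j \<in> {1..H}" for j
          unfolding v_y[OF that] by (simp add: window_def y_def \<eta>_def Let_def)
        ultimately show "proxy t (window H (y (Suc i)) t) - proxy t (window H z t)
            \<le> (1 - \<eta>) * (proxy t (window H (y i) t) - proxy t (window H z t))
            + \<eta> * (?l t (window H (a (Suc i)) t) - ?l t (window H z t)) + \<eta>\<^sup>2 * (\<beta> * real H * D\<^sup>2 / 2)"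
          using frank_wolfe_step[OF smooth _ U(2) params(3) \<eta> v_tuples, of "window H (a (Suc i)) t"
              "window H z t" "window H (y (Suc i)) t"] losses_convex t a_U y_U z_U U(3)
          by (simp add: window_in_tuples D_def)
      qed
      also have "\<dots> = (1 - \<eta>) * \<Delta> i + \<eta> * ((\<Sum>t=1..T. ?l t (window H (a (Suc i)) t))
          - (\<Sum>t=1..T. ?l t (window H z t))) + \<eta>\<^sup>2 * K"
        by (simp add: \<Delta>_def K_def sum.distrib sum_distrib_left[symmetric] sum_subtractf)
      \<comment> \<open>The regret of copy \<open>Suc i\<close>, extended to the mixture
        \<open>\<pi>\<close>, makes its actions an approximate solution of the linear
        subproblem.\<close>
      also have "\<dots> \<le> (1 - \<eta>) * \<Delta> i + \<eta> * \<rho> + \<eta>\<^sup>2 * K"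
        using linear_regret_conv_policies[OF U(2,3) policies(1,2) regret[of "Suc i"] \<pi>] \<eta>
        unfolding z_def \<rho>_def by (intro add_right_mono add_left_mono mult_left_mono)
      finally show ?thesis unfolding \<eta>_def .
    qed
    from frank_wolfe_recurrence[of \<Delta>, OF this K, of "N - 1"]
    have "\<Delta> N \<le> 4 * K / (real N + 1) + \<rho>" using params(2) by simp
    also have "\<dots> \<le> 4 * K / real N + \<rho>"
      using K params(2) by (intro add_right_mono divide_left_mono) auto
    finally have gap: "\<Delta> N \<le> 2 * \<beta> * D\<^sup>2 * real H * real T / real N + \<rho>"
      by (simp add: K_def mult_ac)
    \<comment> \<open>Bounded memory is used once for \<open>u\<close> and once for
      \<open>z\<close>. The resulting \<open>2 * \<epsilon>\<close> per round joins the
      \<open>2 * real T * \<epsilon>\<close> inside \<open>\<rho>\<close> to give the factor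
      4.\<close>
    have "(\<Sum>t=1..T. loss t u - loss t z)
        \<le> (\<Sum>t=1..T. proxy t (window H (y N) t) - proxy t (window H z t) + 2 * \<epsilon>)"
    proof (rule sum_mono)
      fix t assume "t \<in> {1..T}"
      from memory[OF u_BM this] memory[OF z_BM this]
      show "loss t u - loss t z \<le> proxy t (window H (y N) t) - proxy t (window H z t) + 2 * \<epsilon>"
        by (simp add: u_y)
    qed
    also have "\<dots> = \<Delta> N + 2 * real T * \<epsilon>"
      by (simp add: \<Delta>_def sum.distrib)
    finally show ?thesis
      using gap by (simp add: \<rho>_def z_def sum_subtractf)
  qed
  have "conv_policies P \<noteq> {}"
  proof -
    obtain p where "p \<in> P" using policies(1) by blast
    then have "(\<lambda>ws. \<Sum>\<pi>\<in>{p}. 1 *\<^sub>R \<pi> ws) \<in> conv_policies P"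
      unfolding conv_policies_def
      by (intro CollectI exI[of _ "{p}"] exI[of _ "\<lambda>_. 1"]) simp
    then show ?thesis by blast
  qed
  then have "(\<Sum>t=1..T. loss t u) - (2 * \<beta> * D\<^sup>2 * real H * real T / real N + R T + 4 * real T * \<epsilon>)
      \<le> (INF \<pi>\<in>conv_policies P. \<Sum>t=1..T. loss t (policy_actions \<pi> w))"
    using bound by (intro cINF_greatest)
  then show ?thesis
    by (simp add: Let_def u_def[symmetric] B_def[symmetric] D_def[symmetric] algebra_simps)
qed

end
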